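(* Let $\mathcal{H}$ be any concept class on a finite instance space $\mathcal{X}$ such that at least one point $x'\in\mathcal{X}$ is classified negative by all $h\in\mathcal{H}$ (i.e. $\{x: h(x)=0\text{ for all }h\in\mathcal{H}\}\neq\emptyset$), and suppose the restriction $\mathcal{H}|_{\mathcal{X}\setminus\{x'\}}$ is not intersection-closed on $\mathcal{X}\setminus\{x'\}$. Then there exist a data distribution $\mathcal{D}$ on $\mathcal{X}$ and an improvement function $\Delta:\mathcal{X}\to2^{\mathcal{X}}$ such that no proper learner can PAC-learn $\mathcal{H}$ with improvements with respect to $\Delta$ and $\mathcal{D}$.
   Context: Classifiers $h:\mathcal{X}\to\{0,1\}$ ($1$ positive, $0$ negative) are identified with the sets $\{x:h(x)=1\}$. A (finite) class $\mathcal{H}$ is intersection-closed if $h_1\cap h_2\in\mathcal{H}$ for all $h_1,h_2\in\mathcal{H}$. For a classifier $h$ the reaction set of $x$ is: $\Delta_h(x)=\{x\}$ if $h(x)=1$; $\Delta_h(x)=\{x\}$ if $\{z\in\Delta(x): h(z)=1\}=\emptyset$; and $\Delta_h(x)=\{z\in\Delta(x):h(z)=1\}$ otherwise. For a target $f^*$, $\mathrm{Loss}(x;h,f^* )=\max_{z\in\Delta_h(x)}\mathbb{I}[h(z)\neq f^*(z)]$ and $\mathrm{Loss}_{\mathcal{D}}(h,f^* )=\mathbb{P}_{x\sim\mathcal{D}}[\mathrm{Loss}(x;h,f^* )=1]$. A learner PAC-learns $\mathcal{H}$ with improvements with respect to $\Delta$ and $\mathcal{D}$ if there is a finite sample size $M(\epsilon,\delta)$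 such that for any $f^*\in\mathcal{H}$ and any $\epsilon,\delta>0$, given $M(\epsilon,\delta)$ i.i.d. examples from $\mathcal{D}$ labeled by $f^*$, it outputs with probability at least $1-\delta$ a hypothesis $h$ with $\mathrm{Loss}_{\mathcal{D}}(h,f^* )\le\epsilon$. It is proper if its output always lies in $\mathcal{H}$. *)

theory Defs
  imports "HOL-Probability.Probability"
begin

text \<open>
  A classifier \<open>h\<close> on the instance space is identified with the set of points that it labels
  positive, so that \<open>h(x) = 1\<close> reads \<open>x \<in> h\<close>, and a concept class is a set of sets.
  That a concept class is intersection-closed is the library predicate \<^const>\<open>Int_stable\<close>.
\<close>

type_synonym 'a classifier = "'a set"

definition restrict_class :: "'a classifier set \<Rightarrow> 'a set \<Rightarrow> 'a classifier set" where
  "restrict_class H Y = (\<lambda>h. h \<inter> Y) ` H"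

definition reaction :: "('a \<Rightarrow> 'a set) \<Rightarrow> 'a classifier \<Rightarrow> 'a \<Rightarrow> 'a set" where
  "reaction \<Delta> h x =
     (if x \<in> h then {x}
      else if {z \<in> \<Delta> x. z \<in> h} = {} then {x}
      else {z \<in> \<Delta> x. z \<in> h})"

text \<open>
  The set under \<^const>\<open>Max\<close> is always a nonempty subset of \<open>{0, 1}\<close>, hence the maximum is
  well-defined whatever \<open>\<Delta>\<close> is.
\<close>

definition loss :: "('a \<Rightarrow> 'a set) \<Rightarrow> 'a \<Rightarrow> 'a classifier \<Rightarrow> 'a classifier \<Rightarrow> nat" where
  "loss \<Delta> x h f = Max ((\<lambda>z. of_bool ((z \<in> h) \<noteq> (z \<in> f))) ` reaction \<Delta> h x)"

definition population_loss ::
    "('a \<Rightarrow> 'a set) \<Rightarrow> 'a pmf \<Rightarrow> 'a classifier \<Rightarrow> 'a classifier \<Rightarrow> real" where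
  "population_loss \<Delta> D h f = measure_pmf.prob D {x. loss \<Delta> x h f = 1}"

text \<open>
  A learner receives \<open>\<epsilon>\<close>, \<open>\<delta>\<close> and a labelled sample and may randomize over its output.
  Deterministic learners are those whose output is a \<^const>\<open>return_pmf\<close>, and learners that do
  not look at \<open>\<epsilon>\<close> and \<open>\<delta>\<close> are those that are constant in them.
\<close>

type_synonym 'a learner = "real \<Rightarrow> real \<Rightarrow> ('a \<times> bool) list \<Rightarrow> 'a classifier pmf"

definition proper_learner :: "'a classifier set \<Rightarrow> 'a learner \<Rightarrow> bool" where
  "proper_learner H A \<longleftrightarrow> (\<forall>\<epsilon> \<delta> S. set_pmf (A \<epsilon> \<delta> S) \<subseteq> H)"

definition label_sample :: "'a classifier \<Rightarrow> 'a list \<Rightarrow> ('a \<times> bool) list" where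
  "label_sample f xs = map (\<lambda>x. (x, x \<in> f)) xs"

text \<open>
  The distribution of the learner's output on \<open>n\<close> i.i.d. examples from \<open>D\<close> labelled by \<open>f\<close>,
  jointly over the sample and the internal randomness of the learner.
\<close>

definition learner_output ::
    "'a learner \<Rightarrow> 'a pmf \<Rightarrow> 'a classifier \<Rightarrow> real \<Rightarrow> real \<Rightarrow> nat \<Rightarrow> 'a classifier pmf" where
  "learner_output A D f \<epsilon> \<delta> n =
     bind_pmf (replicate_pmf n D) (\<lambda>xs. A \<epsilon> \<delta> (label_sample f xs))"

definition PAC_learns_with_improvements ::
    "'a learner \<Rightarrow> 'a classifier set \<Rightarrow> ('a \<Rightarrow> 'a set) \<Rightarrow> 'a pmf \<Rightarrow> bool" where
  "PAC_learns_with_improvements A H \<Delta> D \<longleftrightarrow>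
     (\<exists>M :: real \<Rightarrow> real \<Rightarrow> nat. \<forall>f\<in>H. \<forall>\<epsilon>>0. \<forall>\<delta>>0.
        measure_pmf.prob (learner_output A D f \<epsilon> \<delta> (M \<epsilon> \<delta>))
          {h. population_loss \<Delta> D h f \<le> \<epsilon>} \<ge> 1 - \<delta>)"

end

(* Pick h1, h2 in H with h1 \<inter> h2 not in H. Let D be uniform on {x'} \<union> (h1 \<inter> h2), and let x' be
   able to improve to every point while no other point can move. On the support of D the targets
   h1 and h2 agree, so the learner's output has the same distribution for both. Zero loss on
   h1 \<inter> h2 forces h to contain h1 \<inter> h2, and zero loss at x' forces h to lie inside the target, so
   an h that is good for both targets would be h1 \<inter> h2 itself, which a proper learner never
   outputs. *)
theory Submission
  imports Defs
begin

lemma loss_eq_1: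
  assumes "finite (reaction \<Delta> h x)" "z \<in> reaction \<Delta> h x" "(z \<in> h) \<noteq> (z \<in> f)"
  shows "loss \<Delta> x h f = 1"
  unfolding loss_def
proof (rule Max_eqI)
  show "1 \<in> (\<lambda>z. of_bool ((z \<in> h) \<noteq> (z \<in> f)) :: nat) ` reaction \<Delta> h x"
    using assms by (intro image_eqI[of _ _ z]) auto
qed (use assms in \<open>auto simp: of_bool_def\<close>)

lemma population_loss_ge_pmf:
  assumes "loss \<Delta> x h f = 1"
  shows "pmf D x \<le> population_loss \<Delta> D h f"
  unfolding population_loss_def measure_pmf_single[symmetric]
  by (rule measure_pmf.finite_measure_mono) (use assms in auto)

text \<open>A sample contains only points of the support of \<open>D\<close>, so its labels cannot
  reveal where \<open>f\<close> and \<open>g\<close> differ outside that support.\<close>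

lemma learner_output_cong:
  assumes "\<And>x. x \<in> set_pmf D \<Longrightarrow> x \<in> f \<longleftrightarrow> x \<in> g"
  shows "learner_output A D f \<epsilon> \<delta> n = learner_output A D g \<epsilon> \<delta> n"
  unfolding learner_output_def
proof (rule bind_pmf_cong)
  fix xs assume "xs \<in> set_pmf (replicate_pmf n D)"
  then have "set xs \<subseteq> set_pmf D"
    by (auto simp: set_replicate_pmf)
  then have "label_sample f xs = label_sample g xs"
    using assms by (auto simp: label_sample_def)
  then show "A \<epsilon> \<delta> (label_sample f xs) = A \<epsilon> \<delta> (label_sample g xs)"
    by simp
qed simp

lemma set_learner_output_subset:
  assumes "proper_learner H A"
  shows "set_pmf (learner_output A D f \<epsilon> \<delta> n) \<subseteq> H"
  using assms by (auto simp: learner_output_def proper_learner_def)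

text \<open>Two-point argument: the output has one and the same distribution \<open>P\<close> under
  both targets, while success for \<open>f\<close> and success for \<open>g\<close> exclude each
  other on \<open>H\<close>.\<close>

lemma not_PAC_learns_if_indistinguishable:
  assumes proper: "proper_learner H A" and f: "f \<in> H" and g: "g \<in> H"
    and agree: "\<And>x. x \<in> set_pmf D \<Longrightarrow> x \<in> f \<longleftrightarrow> x \<in> g"
    and "\<epsilon> > 0"
    and sep: "\<And>h. h \<in> H \<Longrightarrow> population_loss \<Delta> D h f > \<epsilon> \<or> population_loss \<Delta> D h g > \<epsilon>"
  shows "\<not> PAC_learns_with_improvements A H \<Delta> D"
proof
  assume "PAC_learns_with_improvements A H \<Delta> D"
  \<comment> \<open>Any \<delta> below 1/2 would do: two disjoint events cannot both have
    probability above 1/2.\<close>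
  then obtain M :: "real \<Rightarrow> real \<Rightarrow> nat" where M: "\<And>t. t \<in> H \<Longrightarrow>
      measure_pmf.prob (learner_output A D t \<epsilon> (1/3) (M \<epsilon> (1/3)))
        {h. population_loss \<Delta> D h t \<le> \<epsilon>} \<ge> 1 - 1/3"
    unfolding PAC_learns_with_improvements_def using \<open>\<epsilon> > 0\<close>
    by (metis divide_pos_pos zero_less_numeral zero_less_one)
  define P where "P = learner_output A D f \<epsilon> (1/3) (M \<epsilon> (1/3))"
  \<comment> \<open>Cutting down to the support of \<open>P\<close> keeps the probabilities and
    leaves only members of \<open>H\<close>, the hypotheses that \<open>sep\<close> speaks
    about.\<close>
  define good where "good t = {h. population_loss \<Delta> D h t \<le> \<epsilon>} \<inter> set_pmf P" for t
  have P: "P = learner_output A D g \<epsilon> (1/3) (M \<epsilon> (1/3))"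
    unfolding P_def by (rule learner_output_cong) (rule agree)
  have "good f \<inter> good g = {}"
    using sep set_learner_output_subset[OF proper] by (fastforce simp: good_def P_def)
  then have "measure_pmf.prob P (good f) + measure_pmf.prob P (good g)
      = measure_pmf.prob P (good f \<union> good g)"
    by (subst measure_pmf.finite_measure_Union) auto
  moreover have "measure_pmf.prob P (good f) \<ge> 2/3"
    using M[OF f] by (simp add: good_def measure_Int_set_pmf flip: P_def)
  moreover have "measure_pmf.prob P (good g) \<ge> 2/3"
    using M[OF g] by (simp add: good_def measure_Int_set_pmf flip: P)
  ultimately show False
    using measure_pmf.prob_le_1[of P "good f \<union> good g"] by linarith
qed

theorem theorem4p8:
  fixes X :: "'a set" and H :: "'a classifier set" and x' :: 'a
  assumes "finite X"
    and "H \<subseteq> Pow X"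
    and "x' \<in> X"
    and "\<forall>h\<in>H. x' \<notin> h"
    and "\<not> Int_stable (restrict_class H (X - {x'}))"
  shows "\<exists>(D :: 'a pmf) (\<Delta> :: 'a \<Rightarrow> 'a set).
           set_pmf D \<subseteq> X \<and> (\<forall>x\<in>X. \<Delta> x \<subseteq> X) \<and>
           \<not> (\<exists>A :: 'a learner. proper_learner H A \<and> PAC_learns_with_improvements A H \<Delta> D)"
proof -
  \<comment> \<open>No member of \<open>H\<close> contains \<open>x'\<close>, so the restriction is
    \<open>H\<close> itself.\<close>
  have "restrict_class H (X - {x'}) = (\<lambda>h. h) ` H"
    unfolding restrict_class_def using assms(2,4) by (intro image_cong) auto
  then obtain h1 h2 where h: "h1 \<in> H" "h2 \<in> H" "h1 \<inter> h2 \<notin> H"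
    using assms(5) by (auto simp: Int_stable_def)
  define S where "S = insert x' (h1 \<inter> h2)"
  define D where "D = pmf_of_set S"
  define \<Delta> where "\<Delta> x = (if x = x' then X else {x})" for x
  \<comment> \<open>Half the mass of a point of \<open>S\<close>, so a loss at a single point of
    \<open>S\<close> already exceeds \<epsilon>.\<close>
  define \<epsilon> where "\<epsilon> = 1 / (2 * real (card S))"
  have "S \<subseteq> X"
    using assms(2,3) h by (auto simp: S_def)
  then have S: "finite S" "S \<noteq> {}"
    using assms(1) finite_subset by (auto simp: S_def)
  then have "card S > 0"
    by (simp add: card_gt_0_iff)
  then have "\<epsilon> > 0"
    by (simp add: \<epsilon>_def)
  have pmf_D: "pmf D x > \<epsilon>" if "x \<in> S" for x
    using S \<open>card S > 0\<close> that by (simp add: D_def \<epsilon>_def field_simps)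
  have set_D: "set_pmf D = S"
    using S by (simp add: D_def)
  have fin: "finite (reaction \<Delta> h x)" for h x
    using assms(1) by (auto simp: reaction_def \<Delta>_def)
  have big_loss: "population_loss \<Delta> D h f > \<epsilon>"
    if "x \<in> S" "z \<in> reaction \<Delta> h x" "(z \<in> h) \<noteq> (z \<in> f)" for h f x z
    using population_loss_ge_pmf[OF loss_eq_1[OF fin that(2,3)], of D] pmf_D[OF that(1)]
    by linarith
  have "population_loss \<Delta> D h h1 > \<epsilon> \<or> population_loss \<Delta> D h h2 > \<epsilon>" if "h \<in> H" for h
  proof (cases "h1 \<inter> h2 \<subseteq> h")
    case False
    then obtain z where "z \<in> h1 \<inter> h2" "z \<notin> h"
      by blast
    \<comment> \<open>Here \<open>z\<close> differs from \<open>x'\<close>, cannot move and is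
      rejected by \<open>h\<close>, although both targets accept it.\<close>
    then show ?thesis
      using assms(4) h by (intro disjI1 big_loss[of z z]) (auto simp: S_def reaction_def \<Delta>_def)
  next
    case True
    moreover have "h \<noteq> h1 \<inter> h2"
      using \<open>h \<in> H\<close> h(3) by blast
    ultimately obtain z where z: "z \<in> h" "z \<notin> h1 \<inter> h2"
      by blast
    \<comment> \<open>As \<open>x'\<close> is rejected by \<open>h\<close> and can reach all of
      \<open>X\<close>, its reaction set is all of \<open>h\<close>; the point \<open>z\<close> is
      then a false positive for \<open>h1\<close> or for \<open>h2\<close>.\<close>
    then have "z \<in> reaction \<Delta> h x'"
      using assms(2,4) \<open>h \<in> H\<close> by (auto simp: reaction_def \<Delta>_def)
    then show ?thesis
      using z big_loss[of x' z] by (auto simp: S_def)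
  qed
  \<comment> \<open>On \<open>S\<close> the targets agree: both reject \<open>x'\<close> and both
    accept \<open>h1 \<inter> h2\<close>.\<close>
  then have "\<not> PAC_learns_with_improvements A H \<Delta> D" if "proper_learner H A" for A
    using that h(1,2) assms(4) \<open>\<epsilon> > 0\<close>
    by (intro not_PAC_learns_if_indistinguishable[of H A h1 h2 D \<epsilon> \<Delta>]) (auto simp: set_D S_def)
  then show ?thesis
    using \<open>S \<subseteq> X\<close> by (intro exI[of _ D] exI[of _ \<Delta>]) (auto simp: set_D \<Delta>_def)
qed

end
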